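(* Let $n,p$ be positive integers with $p \ge n$, let $X\in\mathbb{R}^{n\times p}$ have columns normalized so that $\|X_j\|_2=\sqrt n$ for all $1\le j\le p$, and let $y = X\beta_\star+z$ with $z\sim\mathcal{N}(0,\sigma^2 I_n)$, where $\beta_\star$ has support of size $s_\star$ with $1\le s_\star\le\overline{s}$. Let $0<\varepsilon\le1/2$ and $c\ge1$, and assume that the sparsity parameter of the prior is $$\lambda=\frac{1+\varepsilon}{\varepsilon}(23+5c)\log p.$$ Then with probability at least $1-3p^{-c}$, $$\|\widehat\beta_{\rm map}-\beta_\star\|_2\le\sigma\sqrt{\frac{8s_\star\lambda}{n\,\nu_{(2+\varepsilon)s_\star}^2}},$$ where the right-hand side is understood as $+\infty$ if $\nu_{(2+\varepsilon)s_\star}=0$.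
   Context: Model: $y=X\beta_\star+z\in\mathbb{R}^n$ with $X\in\mathbb{R}^{n\times p}$ deterministic, $z\sim\mathcal{N}(0,\sigma^2 I_n)$ and $\sigma>0$ known. The vector $\beta_\star\in\mathbb{R}^p$ is one of the vectors $\beta$ of minimal support size among those satisfying $X\beta=\mathbb{E}(y)$; $J_\star\subset[p]:=\{1,\dots,p\}$ is its support and $s_\star=|J_\star|$. $\|\cdot\|_2$ is the Euclidean norm. For $J\subset[p]$, $X_J$ is the submatrix of $X$ with columns $X_j$, $j\in J$; $P_J$ is the orthogonal projection of $\mathbb{R}^n$ onto the span of $\{X_j: j\in J\}$, and $P_J^\perp=I_n-P_J$. Prior and pseudo-posterior: fix an integer upper bound $\overline{s}\le p$ on the support size (with $s_\star\le\overline{s}$) and a parameter $\lambda>0$. The prior on subsets $J\subset[p]$ is the probability distribution $\pi(J)\propto\binom{p}{|J|}^{-1}e^{-\lambda|J|}\mathbf{1}_{\{|J|\le\overline{s}\}}$, and the pseudo-posterior is the probability distribution $\Pi(J)\propto\pi(J)\exp\left(-\frac{\|P_J^\perp y\|_2^2}{2\sigma^2}\right)$. Estimator: for $J\subset[p]$, $\widehat\beta_J$ is the minimum-Euclidean-norm least squares coefficient vector for regressing $y$ on $X_J$, viewed as a vector of $\mathbb{R}^p$ by setting coordinates outside $J$ to $0$. $\widehat J_{\rm map}\in\arg\max_J\Pi(J)$ and $\widehat\beta_{\rm map}=\widehat\beta_{\widehat J_{\rm map}}$. For real $s\ge1$, $$\nu_s=\min_{J\subset[p],\,1\le|J|\le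 s}\ \min_{u\in\mathbb{R}^{|J|},\,\|u\|_2=1}\frac1{\sqrt n}\|X_Ju\|_2.$$ *)

theory Defs
  imports "HOL-Probability.Probability"
begin

definition coef_support :: "real ^ 'p \<Rightarrow> 'p set" where
  "coef_support \<beta> = {j. \<beta> $ j \<noteq> 0}"

text \<open>\<open>\<beta>\<close> has minimal support size among the solutions of \<open>X \<beta> = m\<close>.\<close>

definition sparsest_solution :: "real ^ 'p ^ 'n \<Rightarrow> real ^ 'n \<Rightarrow> real ^ 'p \<Rightarrow> bool" where
  "sparsest_solution X m \<beta> \<longleftrightarrow>
     X *v \<beta> = m \<and>
     (\<forall>\<beta>'. X *v \<beta>' = m \<longrightarrow> card (coef_support \<beta>) \<le> card (coef_support \<beta>'))"

text \<open>The law \<open>N(0, \<sigma>\<^sup>2 I)\<close>, given by its Lebesgue density (\<open>normal_density\<close> takes the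
  standard deviation, not the variance).\<close>

definition isotropic_gaussian :: "'a measure \<Rightarrow> real \<Rightarrow> ('a \<Rightarrow> real ^ 'n) \<Rightarrow> bool" where
  "isotropic_gaussian M \<sigma> z \<longleftrightarrow>
     distributed M lborel z (\<lambda>x. ennreal (\<Prod>i\<in>UNIV. normal_density 0 \<sigma> (x $ i)))"

definition orth_proj :: "(real ^ 'n) set \<Rightarrow> real ^ 'n \<Rightarrow> real ^ 'n" where
  "orth_proj S y = (THE v. v \<in> S \<and> (\<forall>w\<in>S. orthogonal (y - v) w))"

definition proj_cols :: "real ^ 'p ^ 'n \<Rightarrow> 'p set \<Rightarrow> real ^ 'n \<Rightarrow> real ^ 'n" where
  "proj_cols X J = orth_proj (span ((\<lambda>j. column j X) ` J))"

definition prior_weight :: "nat \<Rightarrow> real \<Rightarrow> ('p::finite) set \<Rightarrow> real" where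
  "prior_weight sbar lam J =
     (if card J \<le> sbar then exp (- lam * real (card J)) / real (CARD('p) choose card J) else 0)"

definition prior :: "nat \<Rightarrow> real \<Rightarrow> ('p::finite) set \<Rightarrow> real" where
  "prior sbar lam J = prior_weight sbar lam J / (\<Sum>K\<in>(UNIV :: 'p set set). prior_weight sbar lam K)"

definition posterior_weight ::
    "nat \<Rightarrow> real \<Rightarrow> real \<Rightarrow> real ^ 'p ^ 'n \<Rightarrow> real ^ 'n \<Rightarrow> ('p::finite) set \<Rightarrow> real" where
  "posterior_weight sbar lam \<sigma> X y J =
     prior sbar lam J * exp (- (norm (y - proj_cols X J y))\<^sup>2 / (2 * \<sigma>\<^sup>2))"

definition posterior ::
    "nat \<Rightarrow> real \<Rightarrow> real \<Rightarrow> real ^ 'p ^ 'n \<Rightarrow> real ^ 'n \<Rightarrow> ('p::finite) set \<Rightarrow> real" where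
  "posterior sbar lam \<sigma> X y J =
     posterior_weight sbar lam \<sigma> X y J / (\<Sum>K\<in>(UNIV :: 'p set set). posterior_weight sbar lam \<sigma> X y K)"

definition is_map_model ::
    "nat \<Rightarrow> real \<Rightarrow> real \<Rightarrow> real ^ 'p ^ 'n \<Rightarrow> real ^ 'n \<Rightarrow> ('p::finite) set \<Rightarrow> bool" where
  "is_map_model sbar lam \<sigma> X y J \<longleftrightarrow> is_arg_max (posterior sbar lam \<sigma> X y) (\<lambda>_. True) J"

text \<open>A coefficient vector indexed by \<open>J\<close> is represented by its extension by zero to all of
  \<open>'p\<close>; for such a vector \<open>b\<close>, the product of the submatrix of columns in \<open>J\<close> with
  its restriction is \<open>X *v b\<close>, and the Euclidean norm is unchanged.\<close>

definition least_squares_on ::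
    "real ^ 'p ^ 'n \<Rightarrow> real ^ 'n \<Rightarrow> 'p set \<Rightarrow> real ^ 'p \<Rightarrow> bool" where
  "least_squares_on X y J b \<longleftrightarrow>
     is_arg_min (\<lambda>b. norm (y - X *v b)) (\<lambda>b. coef_support b \<subseteq> J) b"

definition beta_hat ::
    "real ^ 'p ^ 'n \<Rightarrow> real ^ 'n \<Rightarrow> 'p set \<Rightarrow> real ^ 'p" where
  "beta_hat X y J = (THE b. is_arg_min norm (least_squares_on X y J) b)"

text \<open>For \<open>s \<ge> 1\<close> both infima are over nonempty sets and are attained.\<close>

definition nu :: "real ^ 'p ^ 'n \<Rightarrow> real \<Rightarrow> real" where
  "nu X s =
     (INF J\<in>{J :: 'p set. 1 \<le> card J \<and> real (card J) \<le> s}.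
        INF u\<in>{u :: real ^ 'p. coef_support u \<subseteq> J \<and> norm u = 1}.
          norm (X *v u) / sqrt (real CARD('n)))"

end

theory Submission
  imports Defs
begin

text \<open>Write \<open>L = ln p\<close>, \<open>P K\<close> for the projection onto the span of the columns in \<open>K\<close>, and let
  \<open>J\<close> be a maximiser with \<open>k\<close> elements, \<open>S\<close> the support of \<open>\<beta>star\<close> with \<open>s\<close> elements and
  \<open>D = X (beta_hat - \<beta>star)\<close>, which lies in the range of \<open>P (J \<union> S)\<close>. Comparing the posterior
  weights of \<open>J\<close> and \<open>S\<close> gives
  \<open>|D|\<^sup>2 / 2 \<le> 2 |P (J \<union> S) z|\<^sup>2 + 2 \<sigma>\<^sup>2 (lam (s - k) + s L)\<close>.
  A chi-square bound and a union bound over all sets \<open>K\<close>, weighted by \<open>p powr (-2 |K|)\<close>, give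
  \<open>|P K z|\<^sup>2 \<le> \<sigma>\<^sup>2 (10 |K| + 4 c) L\<close> for all nonempty \<open>K\<close> simultaneously, with probability at
  least \<open>1 - 3 p powr (-c)\<close>. For \<open>k > (1 + \<epsilon>) s\<close> the right-hand side would then be negative; for
  \<open>k \<le> (1 + \<epsilon>) s\<close> it is at most \<open>4 \<sigma>\<^sup>2 s lam\<close>, and \<open>beta_hat - \<beta>star\<close> is supported on at most
  \<open>(2 + \<epsilon>) s\<close> coordinates, so \<open>nu\<close> turns the bound on \<open>D\<close> into one on \<open>beta_hat - \<beta>star\<close>.\<close>

subsection \<open>Gaussian integrals\<close>

lemma borel_measurable_linear:
  fixes f :: "'a::euclidean_space \<Rightarrow> 'b::euclidean_space"
  assumes "linear f"
  shows "f \<in> borel_measurable borel"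
  using assms
  by (intro borel_measurable_continuous_onI linear_continuous_on linear_conv_bounded_linear[THEN iffD1])

lemma nn_integral_lborel_plus:
  fixes g :: "'a::euclidean_space \<Rightarrow> ennreal"
  assumes [measurable]: "g \<in> borel_measurable borel"
  shows "(\<integral>\<^sup>+x. g (x + t) \<partial>lborel) = (\<integral>\<^sup>+x. g x \<partial>lborel)"
proof -
  have "(\<integral>\<^sup>+x. g x \<partial>lborel) = (\<integral>\<^sup>+x. g x \<partial>distr lborel borel ((+) t))"
    by (simp add: lborel_distr_plus)
  also have "\<dots> = (\<integral>\<^sup>+x. g (t + x) \<partial>lborel)"
    by (subst nn_integral_distr) auto
  finally show ?thesis by (simp add: add.commute)
qed

text \<open>Two translation-invariant measures are proportional by Tonelli's theorem; the unit ball,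
  which an orthogonal map preserves, shows that the factor is 1.\<close>

lemma nn_integral_lborel_orthogonal:
  fixes f :: "'a::euclidean_space \<Rightarrow> 'a" and g :: "'a \<Rightarrow> ennreal"
  assumes f: "orthogonal_transformation f" and g[measurable]: "g \<in> borel_measurable borel"
  shows "(\<integral>\<^sup>+x. g (f x) \<partial>lborel) = (\<integral>\<^sup>+x. g x \<partial>lborel)"
proof -
  define h :: "'a \<Rightarrow> ennreal" where "h = indicator (ball 0 1)"
  have lin: "linear f" using f by (rule orthogonal_transformation_linear)
  have [measurable]: "f \<in> borel_measurable borel"
    using lin by (rule borel_measurable_linear)
  have [measurable]: "h \<in> borel_measurable borel"
    unfolding h_def by (intro borel_measurable_indicator) simp
  define H where "H = (\<integral>\<^sup>+y. h y \<partial>lborel)"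
  have H: "H = emeasure lborel (ball (0::'a) 1)" by (simp add: H_def h_def)
  have Hfin: "H \<noteq> \<infinity>" using H emeasure_lborel_ball_finite[of "0::'a" 1] by auto
  have Hpos: "H \<noteq> 0"
    using content_ball_pos[of 1 "0::'a"] by (auto simp: H measure_def)
  \<comment> \<open>A preimage of \<open>y\<close> turns translation of \<open>f x\<close> by
    \<open>y\<close> into translation of \<open>x\<close> by \<open>i y\<close>. This is used both
    to introduce \<open>y\<close> into \<open>g\<close> and, after the two exchanges of integrals,
    to remove it from \<open>h\<close>.\<close>
  obtain i where i: "\<And>y. f (i y) = y"
    using orthogonal_transformation_surj[OF f] by (metis surj_def)
  have hf: "h (- f x) = h x" for x
    by (simp add: h_def indicator_def orthogonal_transformation_norm[OF f])
  have "(\<integral>\<^sup>+x. g (f x) \<partial>lborel) * H = (\<integral>\<^sup>+y. (\<integral>\<^sup>+x. g (f x) * h y \<partial>lborel) \<partial>lborel)"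
    by (simp add: nn_integral_multc nn_integral_cmult H_def)
  also have "\<dots> = (\<integral>\<^sup>+y. (\<integral>\<^sup>+x. g (f x + y) * h y \<partial>lborel) \<partial>lborel)"
  proof (rule nn_integral_cong)
    fix y
    show "(\<integral>\<^sup>+x. g (f x) * h y \<partial>lborel) = (\<integral>\<^sup>+x. g (f x + y) * h y \<partial>lborel)"
      using nn_integral_lborel_plus[of "\<lambda>x. g (f x) * h y" "i y"]
      by (simp add: linear_add[OF lin] i)
  qed
  also have "\<dots> = (\<integral>\<^sup>+x. (\<integral>\<^sup>+y. g (f x + y) * h y \<partial>lborel) \<partial>lborel)"
    by (rule lborel_pair.Fubini') simp
  also have "\<dots> = (\<integral>\<^sup>+x. (\<integral>\<^sup>+y. g y * h (y - f x) \<partial>lborel) \<partial>lborel)"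
  proof (rule nn_integral_cong)
    fix x
    show "(\<integral>\<^sup>+y. g (f x + y) * h y \<partial>lborel) = (\<integral>\<^sup>+y. g y * h (y - f x) \<partial>lborel)"
      using nn_integral_lborel_plus[of "\<lambda>y. g y * h (y - f x)" "f x"]
      by (simp add: add.commute)
  qed
  also have "\<dots> = (\<integral>\<^sup>+y. (\<integral>\<^sup>+x. g y * h (y - f x) \<partial>lborel) \<partial>lborel)"
    by (rule lborel_pair.Fubini') simp
  also have "\<dots> = (\<integral>\<^sup>+y. g y * H \<partial>lborel)"
  proof (rule nn_integral_cong)
    fix y
    have "(\<integral>\<^sup>+x. g y * h (y - f x) \<partial>lborel) = (\<integral>\<^sup>+x. g y * h (- f x) \<partial>lborel)"
      using nn_integral_lborel_plus[of "\<lambda>x. g y * h (y - f x)" "i y"]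
      by (simp add: linear_add[OF lin] i)
    then show "(\<integral>\<^sup>+x. g y * h (y - f x) \<partial>lborel) = g y * H"
      by (simp add: hf nn_integral_cmult H_def)
  qed
  also have "\<dots> = (\<integral>\<^sup>+y. g y \<partial>lborel) * H"
    by (simp add: nn_integral_multc)
  finally show ?thesis
    using Hfin Hpos by (simp add: mult.commute[of _ H] ennreal_mult_cancel_left)
qed

text \<open>The map multiplies the coordinate along \<open>q\<close> by \<open>a\<close>, so it has
  determinant \<open>a\<close>. It is written through \<open>q\<close> alone so that an orthogonal
  map can carry it to any unit direction.\<close>

lemma nn_integral_lborel_stretch:
  fixes q :: "'a::euclidean_space" and g :: "'a \<Rightarrow> ennreal"
  assumes q: "q \<in> Basis" and a: "a > 0" and g[measurable]: "g \<in> borel_measurable borel"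
  shows "ennreal a * (\<integral>\<^sup>+x. g (x + ((a - 1) * (q \<bullet> x)) *\<^sub>R q) \<partial>lborel) = (\<integral>\<^sup>+x. g x \<partial>lborel)"
proof -
  define c where "c j = (if j = q then a else 1)" for j
  define T where "T x = 0 + (\<Sum>j\<in>Basis. (c j * (x \<bullet> j)) *\<^sub>R j)" for x :: 'a
  have T: "T x = x + ((a - 1) * (q \<bullet> x)) *\<^sub>R q" for x
  proof (rule euclidean_eqI)
    fix b :: 'a assume b: "b \<in> Basis"
    show "T x \<bullet> b = (x + ((a - 1) * (q \<bullet> x)) *\<^sub>R q) \<bullet> b"
      using b q inner_sum_left_Basis[OF b, of "\<lambda>j. c j * (x \<bullet> j)"]
      by (auto simp: T_def c_def inner_add_left inner_Basis inner_commute[of x q] algebra_simps)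
  qed
  have [measurable]: "T \<in> borel_measurable borel" unfolding T[abs_def] by measurable
  have pc: "(\<Prod>j\<in>(Basis::'a set). \<bar>c j\<bar>) = a"
    using q a by (simp add: c_def prod.If_cases abs_if if_distrib[of abs])
  have "lborel = density (distr lborel borel T) (\<lambda>_. ennreal a)"
    using lborel_affine_euclidean[of c 0] a unfolding T_def[abs_def] c_def pc[unfolded c_def] by auto
  then have "(\<integral>\<^sup>+x. g x \<partial>lborel) = (\<integral>\<^sup>+x. g x \<partial>density (distr lborel borel T) (\<lambda>_. ennreal a))"
    by simp
  also have "\<dots> = ennreal a * (\<integral>\<^sup>+x. g (T x) \<partial>lborel)"
    by (simp add: nn_integral_density nn_integral_distr nn_integral_cmult)
  finally show ?thesis by (simp add: T)
qed

text \<open>An orthogonal map taking a coordinate vector to \<open>q\<close> conjugates the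
  coordinate stretch into this one, and the integrals are invariant under it.\<close>

lemma nn_integral_lborel_rank_one:
  fixes q :: "real ^ 'n" and g :: "real ^ 'n \<Rightarrow> ennreal"
  assumes q: "norm q = 1" and a: "a > 0" and g[measurable]: "g \<in> borel_measurable borel"
  shows "ennreal a * (\<integral>\<^sup>+x. g (x + ((a - 1) * (q \<bullet> x)) *\<^sub>R q) \<partial>lborel) = (\<integral>\<^sup>+x. g x \<partial>lborel)"
proof -
  \<comment> \<open>Any coordinate vector will do; \<open>undefined\<close> merely names an
    index.\<close>
  define e :: "real ^ 'n" where "e = axis undefined 1"
  have e: "e \<in> Basis" by (auto simp: e_def Basis_vec_def)
  obtain F where F: "orthogonal_transformation F" and Fe: "F e = q"
    using orthogonal_transformation_exists[of e q] q e by auto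
  have lin: "linear F" using F by (rule orthogonal_transformation_linear)
  have [measurable]: "F \<in> borel_measurable borel"
    using lin by (rule borel_measurable_linear)
  have FT: "F (x + ((a - 1) * (e \<bullet> x)) *\<^sub>R e) = F x + ((a - 1) * (q \<bullet> F x)) *\<^sub>R q" for x
    using F by (simp add: linear_add[OF lin] linear_scale[OF lin] Fe orthogonal_transformation_def flip: Fe)
  have "(\<integral>\<^sup>+x. g (x + ((a - 1) * (q \<bullet> x)) *\<^sub>R q) \<partial>lborel)
      = (\<integral>\<^sup>+x. g (F x + ((a - 1) * (q \<bullet> F x)) *\<^sub>R q) \<partial>lborel)"
    by (rule nn_integral_lborel_orthogonal[OF F, symmetric]) simp
  also have "\<dots> = (\<integral>\<^sup>+x. g (F (x + ((a - 1) * (e \<bullet> x)) *\<^sub>R e)) \<partial>lborel)"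
    by (simp add: FT)
  finally have "ennreal a * (\<integral>\<^sup>+x. g (x + ((a - 1) * (q \<bullet> x)) *\<^sub>R q) \<partial>lborel) = (\<integral>\<^sup>+x. g (F x) \<partial>lborel)"
    using nn_integral_lborel_stretch[OF e a, of "\<lambda>x. g (F x)"] by simp
  then show ?thesis by (simp add: nn_integral_lborel_orthogonal[OF F])
qed

text \<open>The density depends on \<open>x\<close> only through \<open>x \<bullet> x\<close>, so
  arbitrary orthonormal directions can be treated like coordinates.\<close>

lemma prod_normal_density_vec:
  fixes x :: "real ^ 'n"
  shows "(\<Prod>i\<in>UNIV. normal_density 0 \<sigma> (x $ i))
    = (1 / sqrt (2 * pi * \<sigma>\<^sup>2)) ^ CARD('n) * exp (- (x \<bullet> x) / (2 * \<sigma>\<^sup>2))"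
proof -
  have "(\<Prod>i\<in>UNIV. normal_density 0 \<sigma> (x $ i))
      = (\<Prod>i\<in>(UNIV::'n set). 1 / sqrt (2 * pi * \<sigma>\<^sup>2)) * (\<Prod>i\<in>UNIV. exp (- (x $ i)\<^sup>2 / (2 * \<sigma>\<^sup>2)))"
    unfolding normal_density_def by (subst prod.distrib[symmetric]) simp
  also have "(\<Prod>i\<in>UNIV. exp (- (x $ i)\<^sup>2 / (2 * \<sigma>\<^sup>2))) = exp (- (x \<bullet> x) / (2 * \<sigma>\<^sup>2))"
    by (simp add: exp_sum[symmetric] inner_vec_def sum_divide_distrib sum_negf power2_eq_square)
  finally show ?thesis by simp
qed

text \<open>The substitution \<open>x \<mapsto> x + (sqrt 2 - 1) (q \<bullet> x) q\<close> absorbs the factor belonging to \<open>q\<close>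
  into the Gaussian density.\<close>

lemma gaussian_mgf_orthonormal:
  fixes B :: "(real ^ 'n) set"
  assumes \<sigma>: "\<sigma> > 0" and "finite B" "pairwise orthogonal B" "\<And>b. b \<in> B \<Longrightarrow> norm b = 1"
  shows "(\<integral>\<^sup>+x. ennreal (exp ((\<Sum>b\<in>B. (b \<bullet> x)\<^sup>2) / (4 * \<sigma>\<^sup>2))) * ennreal (\<Prod>i\<in>UNIV. normal_density 0 \<sigma> (x $ i)) \<partial>lborel)
    = ennreal (sqrt 2 ^ card B) * (\<integral>\<^sup>+x. ennreal (\<Prod>i\<in>UNIV. normal_density 0 \<sigma> (x $ i)) \<partial>(lborel :: (real ^ 'n) measure))"
  using assms(2-4)
proof (induction B rule: finite_induct)
  case empty
  then show ?case by simp
next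
  case (insert q B)
  define C where "C = (1 / sqrt (2 * pi * \<sigma>\<^sup>2)) ^ CARD('n)"
  define G where "G B x = ennreal (exp ((\<Sum>b\<in>B. (b \<bullet> x)\<^sup>2) / (4 * \<sigma>\<^sup>2)) * (C * exp (- (x \<bullet> x) / (2 * \<sigma>\<^sup>2))))"
    for B and x :: "real ^ 'n"
  have C0: "C \<ge> 0" by (simp add: C_def)
  have G: "ennreal (exp ((\<Sum>b\<in>B. (b \<bullet> x)\<^sup>2) / (4 * \<sigma>\<^sup>2))) * ennreal (\<Prod>i\<in>UNIV. normal_density 0 \<sigma> (x $ i)) = G B x" for B x
    unfolding prod_normal_density_vec G_def C_def[symmetric]
    using C0 by (simp add: ennreal_mult)
  have [measurable]: "G B \<in> borel_measurable borel" for B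
    unfolding G_def by measurable
  have q: "norm q = 1" using insert.prems by auto
  then have qq: "q \<bullet> q = 1" by (simp add: norm_eq_1)
  have bq: "b \<bullet> q = 0" if "b \<in> B" for b
    using insert.prems(1) insert.hyps(2) that by (auto simp: pairwise_insert orthogonal_def)
  \<comment> \<open>With \<open>t = q \<bullet> x\<close>, the stretch by \<open>sqrt 2\<close>
    turns \<open>t\<^sup>2\<close> into \<open>2 * t\<^sup>2\<close>. The new term contributes
    \<open>2 * t\<^sup>2 / (4 * \<sigma>\<^sup>2)\<close> to the exponent, while the growth of the
    squared norm removes \<open>t\<^sup>2 / (2 * \<sigma>\<^sup>2)\<close>, which is the same
    amount.\<close>
  have GT: "G (insert q B) (x + ((sqrt 2 - 1) * (q \<bullet> x)) *\<^sub>R q) = G B x" for x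
  proof -
    define t where "t = q \<bullet> x"
    let ?y = "x + ((sqrt 2 - 1) * t) *\<^sub>R q"
    have qy: "(q \<bullet> ?y)\<^sup>2 = 2 * t\<^sup>2"
      by (simp add: inner_add_right qq t_def[symmetric] power2_eq_square algebra_simps)
    have by': "b \<bullet> ?y = b \<bullet> x" if "b \<in> B" for b
      using bq[OF that] by (simp add: inner_add_right)
    have yy: "?y \<bullet> ?y = x \<bullet> x + t\<^sup>2"
    proof -
      have "?y \<bullet> ?y = x \<bullet> x + 2 * ((sqrt 2 - 1) * t) * t + ((sqrt 2 - 1) * t)\<^sup>2"
        by (simp add: inner_add_right inner_add_left qq t_def inner_commute[of x q] power2_eq_square distrib_left)
      also have "\<dots> = x \<bullet> x + (sqrt 2 * sqrt 2 - 1) * t\<^sup>2"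
        by (simp only: power2_eq_square) (simp add: algebra_simps)
      finally show ?thesis by simp
    qed
    have s: "(\<Sum>b\<in>insert q B. (b \<bullet> ?y)\<^sup>2) = 2 * t\<^sup>2 + (\<Sum>b\<in>B. (b \<bullet> x)\<^sup>2)"
      using insert.hyps by (simp add: qy by')
    have "exp ((\<Sum>b\<in>insert q B. (b \<bullet> ?y)\<^sup>2) / (4 * \<sigma>\<^sup>2)) * exp (- (?y \<bullet> ?y) / (2 * \<sigma>\<^sup>2))
        = exp ((\<Sum>b\<in>B. (b \<bullet> x)\<^sup>2) / (4 * \<sigma>\<^sup>2)) * exp (- (x \<bullet> x) / (2 * \<sigma>\<^sup>2))"
      unfolding s yy exp_add[symmetric] using \<sigma> by (simp add: field_simps)
    then show ?thesis unfolding G_def t_def[symmetric] by (simp add: mult.left_commute)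
  qed
  have IH: "(\<integral>\<^sup>+x. G B x \<partial>lborel) = ennreal (sqrt 2 ^ card B) * (\<integral>\<^sup>+x. ennreal (\<Prod>i\<in>UNIV. normal_density 0 \<sigma> (x $ i)) \<partial>(lborel :: (real ^ 'n) measure))"
    using insert unfolding G by (simp add: pairwise_insert)
  have "(\<integral>\<^sup>+x. G (insert q B) x \<partial>lborel) = ennreal (sqrt 2) * (\<integral>\<^sup>+x. G B x \<partial>lborel)"
    using nn_integral_lborel_rank_one[OF q, of "sqrt 2" "G (insert q B)"] by (simp add: GT)
  then show ?case
    unfolding G IH using insert.hyps by (simp add: ennreal_mult mult.assoc)
qed

subsection \<open>Projections and least squares\<close>

text \<open>Uniqueness behind the definite description: the difference of two candidates lies in
  \<open>S\<close> and is orthogonal to itself.\<close>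

lemma orth_proj_eqI:
  assumes S: "subspace S" and v: "v \<in> S" "\<And>w. w \<in> S \<Longrightarrow> orthogonal (y - v) w"
  shows "orth_proj S y = v"
  unfolding orth_proj_def
proof (rule the_equality)
  fix u assume u: "u \<in> S \<and> (\<forall>w\<in>S. orthogonal (y - u) w)"
  have "u - v \<in> S" using S u v(1) by (simp add: subspace_diff)
  then have "orthogonal (y - v) (u - v)" "orthogonal (y - u) (u - v)" using u v(2) by auto
  then have "(u - v) \<bullet> (u - v) = 0"
    by (simp add: orthogonal_def inner_diff_left)
  then show "u = v" by simp
qed (use v in auto)

text \<open>The explicit expansion yields linearity of the projection and reduces its squared norm
  at a Gaussian vector to a sum of squared coordinates.\<close>

lemma orth_proj_orthonormal_basis:
  fixes S :: "(real ^ 'n) set"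
  assumes S: "subspace S"
  obtains B where "finite B" "pairwise orthogonal B" "\<And>b. b \<in> B \<Longrightarrow> norm b = 1" "card B = dim S"
    "span B = S" "\<And>y. orth_proj S y = (\<Sum>b\<in>B. (b \<bullet> y) *\<^sub>R b)"
proof -
  obtain B where B: "B \<subseteq> S" "pairwise orthogonal B" "\<And>x. x \<in> B \<Longrightarrow> norm x = 1"
    "independent B" "card B = dim S" "span B = S"
    using orthonormal_basis_subspace[OF S] by blast
  have fin: "finite B" using B(4) independent_imp_finite by blast
  have "orth_proj S y = (\<Sum>b\<in>B. (b \<bullet> y) *\<^sub>R b)" for y
  proof (rule orth_proj_eqI[OF S])
    show "(\<Sum>b\<in>B. (b \<bullet> y) *\<^sub>R b) \<in> S"
      using S B(1) by (intro subspace_sum subspace_scale) auto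
    fix w assume "w \<in> S"
    then have w: "w \<in> span B" using B by simp
    have "orthogonal (y - (\<Sum>b\<in>B. (b \<bullet> y) *\<^sub>R b)) b" if b: "b \<in> B" for b
    proof -
      have "(\<Sum>c\<in>B. (c \<bullet> y) * (c \<bullet> b)) = (\<Sum>c\<in>B. if c = b then b \<bullet> y else 0)"
        using B(2,3) b by (intro sum.cong) (auto simp: pairwise_def orthogonal_def norm_eq_1)
      then show ?thesis
        using fin b by (simp add: orthogonal_def inner_diff_left inner_sum_left inner_commute[of y b])
    qed
    then show "orthogonal (y - (\<Sum>b\<in>B. (b \<bullet> y) *\<^sub>R b)) w"
      using w orthogonal_to_span by blast
  qed
  with B fin that show ?thesis by blast
qed

context
  fixes S :: "(real ^ 'n) set"
  assumes S: "subspace S"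
begin

lemma orth_proj_in: "orth_proj S y \<in> S"
  and orth_proj_orthogonal: "w \<in> S \<Longrightarrow> (y - orth_proj S y) \<bullet> w = 0"
proof -
  obtain v z where "v \<in> span S" "\<And>w. w \<in> span S \<Longrightarrow> orthogonal z w" "y = v + z"
    using orthogonal_subspace_decomp_exists[of S y] by blast
  then have v: "v \<in> S" "\<And>w. w \<in> S \<Longrightarrow> orthogonal (y - v) w"
    using span_eq_iff[THEN iffD2, OF S] by simp_all
  have "orth_proj S y = v" using orth_proj_eqI[OF S v] by simp
  then show "orth_proj S y \<in> S" "w \<in> S \<Longrightarrow> (y - orth_proj S y) \<bullet> w = 0"
    using v by (auto simp: orthogonal_def)
qed

lemma linear_orth_proj: "linear (orth_proj S)"
proof -
  obtain B where "\<And>y. orth_proj S y = (\<Sum>b\<in>B. (b \<bullet> y) *\<^sub>R b)"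
    using orth_proj_orthonormal_basis[OF S] by metis
  then have "orth_proj S = (\<lambda>y. \<Sum>b\<in>B. (b \<bullet> y) *\<^sub>R b)" by auto
  moreover have "linear (\<lambda>y. \<Sum>b\<in>B. (b \<bullet> y) *\<^sub>R b)"
    by (rule linearI) (simp_all add: inner_add_right scaleR_add_left sum.distrib scaleR_sum_right)
  ultimately show ?thesis by simp
qed

lemma norm_sq_diff_orth_proj:
  assumes "w \<in> S"
  shows "(norm (y - w))\<^sup>2 = (norm (y - orth_proj S y))\<^sup>2 + (norm (orth_proj S y - w))\<^sup>2"
proof -
  have "(y - orth_proj S y) \<bullet> (orth_proj S y - w) = 0"
    using S assms orth_proj_in by (intro orth_proj_orthogonal) (simp add: subspace_diff)
  then have "orthogonal (y - orth_proj S y) (orth_proj S y - w)" by (simp add: orthogonal_def)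
  from norm_add_Pythagorean[OF this] show ?thesis by simp
qed

lemma norm_diff_orth_proj_le: "w \<in> S \<Longrightarrow> norm (y - orth_proj S y) \<le> norm (y - w)"
  using norm_sq_diff_orth_proj[of w y] by (simp add: power2_le_imp_le)

lemma inner_orth_proj: "w \<in> S \<Longrightarrow> orth_proj S y \<bullet> w = y \<bullet> w"
  using orth_proj_orthogonal[of w y] by (simp add: inner_diff_left)

end

section \<open>Column spans, least squares and the minimum-norm solution\<close>

lemma subspace_coef_support: "subspace {b :: real ^ 'p. coef_support b \<subseteq> J}"
proof -
  have "{b :: real ^ 'p. coef_support b \<subseteq> J} = {b. \<forall>j\<in>-J. b $ j = 0}"
    by (auto simp: coef_support_def)
  moreover have "subspace {b :: real ^ 'p. \<forall>j\<in>-J. b $ j = 0}"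
    by (rule subspaceI) simp_all
  ultimately show ?thesis by (simp only:)
qed

text \<open>Connects projections onto column spans with coefficient vectors extended by zero:
  \<open>axis j 1\<close> produces column \<open>j\<close>, and conversely \<open>X *v b\<close> is
  a combination of the columns on the support of \<open>b\<close>.\<close>

lemma span_columns_eq:
  fixes X :: "real ^ 'p ^ 'n"
  shows "span ((\<lambda>j. column j X) ` J) = (\<lambda>b. X *v b) ` {b. coef_support b \<subseteq> J}"
proof
  have "subspace ((\<lambda>b. X *v b) ` {b. coef_support b \<subseteq> J})"
    by (intro linear_subspace_image matrix_vector_mul_linear subspace_coef_support)
  moreover have "column j X \<in> (\<lambda>b. X *v b) ` {b. coef_support b \<subseteq> J}" if "j \<in> J" for j
    using that by (intro image_eqI[of _ _ "axis j 1"]) (auto simp: coef_support_def axis_def matrix_vector_mult_basis[unfolded axis_def])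
  ultimately show "span ((\<lambda>j. column j X) ` J) \<subseteq> (\<lambda>b. X *v b) ` {b. coef_support b \<subseteq> J}"
    by (intro span_minimal) auto
next
  have "X *v b \<in> span ((\<lambda>j. column j X) ` J)" if "coef_support b \<subseteq> J" for b
  proof -
    have "X *v b = (\<Sum>j\<in>UNIV. b $ j *s column j X)" by (rule matrix_mult_sum)
    also have "\<dots> \<in> span ((\<lambda>j. column j X) ` J)"
    proof (rule span_sum)
      fix j show "b $ j *s column j X \<in> span ((\<lambda>j. column j X) ` J)"
      proof (cases "b $ j = 0")
        case True
        then show ?thesis by (simp add: span_zero)
      next
        case False
        then have "j \<in> J" using that by (auto simp: coef_support_def)
        then show ?thesis
          unfolding scalar_mult_eq_scaleR by (intro span_scale span_base imageI)
      qed
    qed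
    finally show ?thesis .
  qed
  then show "(\<lambda>b. X *v b) ` {b. coef_support b \<subseteq> J} \<subseteq> span ((\<lambda>j. column j X) ` J)" by auto
qed

lemma mult_in_span_columns: "coef_support b \<subseteq> J \<Longrightarrow> X *v b \<in> span ((\<lambda>j. column j X) ` J)"
  unfolding span_columns_eq by blast

text \<open>By Pythagoras the squared residual exceeds its value at the projection by the squared
  distance from \<open>X *v b\<close> to the projection, so the minimisers are the preimages of the
  projection.\<close>

lemma least_squares_on_iff:
  "least_squares_on X y J b \<longleftrightarrow> coef_support b \<subseteq> J \<and> X *v b = proj_cols X J y"
proof -
  let ?S = "span ((\<lambda>j. column j X) ` J)"
  have sub: "subspace ?S" by simp
  have P: "proj_cols X J y = orth_proj ?S y" by (simp add: proj_cols_def)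
  obtain b0 where b0: "coef_support b0 \<subseteq> J" "X *v b0 = proj_cols X J y"
    using orth_proj_in[OF sub, of y] unfolding P span_columns_eq by fastforce
  show ?thesis
  proof
    assume L: "least_squares_on X y J b"
    then have b: "coef_support b \<subseteq> J" and le: "norm (y - X *v b) \<le> norm (y - X *v b0)"
      using b0(1) by (auto simp: least_squares_on_def is_arg_min_linorder)
    have "(norm (y - X *v b))\<^sup>2 \<le> (norm (y - X *v b0))\<^sup>2" using le by (intro power_mono) auto
    then show "coef_support b \<subseteq> J \<and> X *v b = proj_cols X J y"
      using norm_sq_diff_orth_proj[OF sub mult_in_span_columns[OF b, of X], of y] b
      unfolding b0(2) P by simp
  next
    assume "coef_support b \<subseteq> J \<and> X *v b = proj_cols X J y"
    then show "least_squares_on X y J b"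
      unfolding least_squares_on_def is_arg_min_linorder P
      by (simp add: norm_diff_orth_proj_le[OF sub mult_in_span_columns])
  qed
qed

text \<open>On the orthogonal complement \<open>W\<close> of the kernel of \<open>X\<close>, within the vectors supported in \<open>J\<close>,
  \<open>X\<close> is injective; the minimum-norm solution is the projection followed by a linear inverse
  of this restriction.\<close>

lemma
  fixes X :: "real ^ 'p ^ 'n"
  shows linear_beta_hat: "linear (\<lambda>y. beta_hat X y J)"
    and coef_support_beta_hat: "coef_support (beta_hat X y J) \<subseteq> J"
    and mult_beta_hat: "X *v beta_hat X y J = proj_cols X J y"
proof -
  define V where "V = {b :: real ^ 'p. coef_support b \<subseteq> J}"
  define N where "N = {b \<in> V. X *v b = 0}"
  define W where "W = {b \<in> V. \<forall>v\<in>N. b \<bullet> v = 0}"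
  have V: "subspace V" unfolding V_def by (rule subspace_coef_support)
  have N: "subspace N"
    unfolding N_def
    by (rule subspaceI) (simp_all add: V subspace_0 subspace_add subspace_scale
        matrix_vector_right_distrib matrix_vector_mult_scaleR)
  have W: "subspace W"
    unfolding W_def
    by (rule subspaceI) (simp_all add: V subspace_0 subspace_add subspace_scale inner_add_left)
  have lin: "linear ((*v) X)" by simp
  have inj: "inj_on ((*v) X) W"
  proof (rule inj_onI)
    fix a b assume ab: "a \<in> W" "b \<in> W" "X *v a = X *v b"
    have d: "a - b \<in> W" using W ab by (simp add: subspace_diff)
    then have "a - b \<in> N" using ab(3) by (simp add: N_def W_def matrix_vector_mult_diff_distrib)
    then have "(a - b) \<bullet> (a - b) = 0" using d by (auto simp: W_def)
    then show "a = b" by simp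
  qed
  obtain g where g: "linear g" "range g \<subseteq> W" "\<And>v. v \<in> W \<Longrightarrow> g (X *v v) = v"
    using linear_exists_left_inverse_on[OF lin W inj] by blast
  define h where "h y = g (proj_cols X J y)" for y
  \<comment> \<open>Removing the component of \<open>b\<close> in \<open>N\<close> leaves its image
    unchanged, so \<open>X\<close> maps \<open>W\<close> onto the whole image of
    \<open>V\<close>.\<close>
  have XW: "\<exists>w\<in>W. X *v w = X *v b" if b: "b \<in> V" for b
  proof
    let ?w = "b - orth_proj N b"
    have p: "orth_proj N b \<in> N" by (rule orth_proj_in[OF N])
    then show "X *v ?w = X *v b" by (simp add: N_def matrix_vector_mult_diff_distrib)
    show "?w \<in> W"
      unfolding W_def
    proof (intro CollectI conjI ballI)
      show "?w \<in> V" using b p by (intro subspace_diff[OF V]) (simp_all add: N_def)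
    qed (rule orth_proj_orthogonal[OF N])
  qed
  have hW: "h y \<in> W" for y using g(2) by (auto simp: h_def)
  have Xh: "X *v h y = proj_cols X J y" for y
  proof -
    have "proj_cols X J y \<in> span ((\<lambda>j. column j X) ` J)"
      unfolding proj_cols_def by (rule orth_proj_in) simp
    then obtain b where "b \<in> V" "proj_cols X J y = X *v b"
      unfolding span_columns_eq V_def[symmetric] by blast
    with XW obtain w where "w \<in> W" "proj_cols X J y = X *v w" by metis
    then show ?thesis using g(3) by (simp add: h_def)
  qed
  have supp: "coef_support (h y) \<subseteq> J" for y using hW by (auto simp: W_def V_def)
  have bh: "beta_hat X y J = h y" for y
  proof -
    \<comment> \<open>Any other least squares solution differs from \<open>h y\<close> by an element
      of \<open>N\<close>, to which \<open>h y\<close> is orthogonal; hence \<open>h y\<close> is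
      the unique shortest one.\<close>
    have pyth: "(norm b)\<^sup>2 = (norm (h y))\<^sup>2 + (norm (b - h y))\<^sup>2" if L: "least_squares_on X y J b" for b
    proof -
      have "b \<in> V" "X *v b = X *v h y" using L by (auto simp: least_squares_on_iff V_def Xh)
      moreover have "h y \<in> V" using hW by (simp add: W_def)
      ultimately have "b - h y \<in> N"
        by (simp add: N_def subspace_diff[OF V] matrix_vector_mult_diff_distrib)
      then have "orthogonal (h y) (b - h y)" using hW by (auto simp: W_def orthogonal_def)
      from norm_add_Pythagorean[OF this] show ?thesis by simp
    qed
    have Lh: "least_squares_on X y J (h y)" using supp Xh by (simp add: least_squares_on_iff)
    show ?thesis
      unfolding beta_hat_def
    proof (rule the_equality)
      have "norm (h y) \<le> norm b" if "least_squares_on X y J b" for b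
        by (rule power2_le_imp_le) (simp_all add: pyth[OF that])
      then show "is_arg_min norm (least_squares_on X y J) (h y)"
        using Lh by (auto simp: is_arg_min_linorder)
    next
      fix b assume "is_arg_min norm (least_squares_on X y J) b"
      then have b: "least_squares_on X y J b" "norm b \<le> norm (h y)"
        using Lh by (auto simp: is_arg_min_linorder)
      have "(norm b)\<^sup>2 \<le> (norm (h y))\<^sup>2" using b(2) by (intro power_mono) auto
      then have "(norm (b - h y))\<^sup>2 \<le> 0" using pyth[OF b(1)] by linarith
      then show "b = h y" by simp
    qed
  qed
  have "linear h"
  proof -
    have "linear (proj_cols X J)" unfolding proj_cols_def by (rule linear_orth_proj) simp
    from linear_compose[OF this g(1)] show ?thesis by (simp add: h_def[abs_def] o_def)
  qed
  then show "linear (\<lambda>y. beta_hat X y J)" by (simp only: bh)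
  show "coef_support (beta_hat X y J) \<subseteq> J" "X *v beta_hat X y J = proj_cols X J y"
    by (simp_all only: bh supp Xh)
qed

subsection \<open>The chi-square union bound\<close>

lemma borel_measurable_orth_proj [measurable]:
  assumes "subspace S" and [measurable]: "f \<in> borel_measurable N"
  shows "(\<lambda>x. orth_proj S (f x)) \<in> borel_measurable N"
proof -
  have "orth_proj S \<in> borel_measurable borel"
    using linear_orth_proj[OF assms(1)] by (rule borel_measurable_linear)
  then show ?thesis by measurable
qed

text \<open>Expansion of a product of \<open>card A\<close> equal factors; it evaluates the total
  weight in the union bound over all column sets.\<close>

lemma sum_power_card_subsets:
  fixes x :: real
  assumes "finite A"
  shows "(\<Sum>K\<in>Pow A. x ^ card K) = (1 + x) ^ card A"
  using prod_add[OF assms, of "\<lambda>_. x" "\<lambda>_. 1"] by (simp add: add.commute)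

lemma dim_span_columns_le:
  fixes X :: "real ^ 'p ^ 'n"
  shows "dim (span ((\<lambda>j. column j X) ` J)) \<le> card J"
  by (metis dim_span dim_le_card' card_image_le finite finite_imageI order_trans)

section \<open>Exponential moments and tails of projected Gaussian noise\<close>

lemma isotropic_gaussian_measurable:
  assumes "isotropic_gaussian M \<sigma> z"
  shows "z \<in> borel_measurable M"
  using assms distributed_measurable[of M lborel z] by (simp add: isotropic_gaussian_def)

lemma isotropic_gaussian_nn_integral:
  assumes "isotropic_gaussian M \<sigma> z" and [measurable]: "g \<in> borel_measurable borel"
  shows "(\<integral>\<^sup>+\<omega>. g (z \<omega>) \<partial>M) = (\<integral>\<^sup>+x. g x * ennreal (\<Prod>i\<in>UNIV. normal_density 0 \<sigma> (x $ i)) \<partial>lborel)"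
  using distributed_nn_integral[OF assms(1)[unfolded isotropic_gaussian_def], of g] by (simp add: mult.commute)

context
  fixes M :: "'a measure" and z :: "'a \<Rightarrow> real ^ 'n" and \<sigma> :: real
  assumes M: "prob_space M" and \<sigma>: "\<sigma> > 0" and z: "isotropic_gaussian M \<sigma> z"
begin

lemmas [measurable] = isotropic_gaussian_measurable[OF z]

text \<open>The chi-square moment generating function with \<open>dim S\<close> degrees of freedom
  at the point 1/4, where each degree contributes
  \<open>(1 - 2/4) powr (-1/2) = sqrt 2\<close>.\<close>

lemma isotropic_gaussian_mgf_orth_proj:
  assumes S: "subspace S"
  shows "(\<integral>\<^sup>+\<omega>. ennreal (exp ((norm (orth_proj S (z \<omega>)))\<^sup>2 / (4 * \<sigma>\<^sup>2))) \<partial>M) = ennreal (sqrt 2 ^ dim S)"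
proof -
  obtain B where B: "finite B" "pairwise orthogonal B" "\<And>b. b \<in> B \<Longrightarrow> norm b = 1" "card B = dim S"
    "span B = S" "\<And>y. orth_proj S y = (\<Sum>b\<in>B. (b \<bullet> y) *\<^sub>R b)"
    by (rule orth_proj_orthonormal_basis[OF S]) (rule that; simp)
  have nrm: "(norm (orth_proj S y))\<^sup>2 = (\<Sum>b\<in>B. (b \<bullet> y)\<^sup>2)" for y
  proof -
    have "pairwise (\<lambda>i j. orthogonal ((i \<bullet> y) *\<^sub>R i) ((j \<bullet> y) *\<^sub>R j)) B"
      by (rule pairwise_mono[OF B(2)]) (simp_all add: orthogonal_def)
    from norm_sum_Pythagorean[OF B(1) this]
    have "(norm (orth_proj S y))\<^sup>2 = (\<Sum>b\<in>B. (norm ((b \<bullet> y) *\<^sub>R b))\<^sup>2)"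
      unfolding B(6) .
    also have "\<dots> = (\<Sum>b\<in>B. (b \<bullet> y)\<^sup>2)"
      by (rule sum.cong) (simp_all add: B(3))
    finally show ?thesis .
  qed
  \<comment> \<open>The density has mass 1 because it is the law of \<open>z\<close> under a
    probability measure.\<close>
  have one: "(\<integral>\<^sup>+x. ennreal (\<Prod>i\<in>UNIV. normal_density 0 \<sigma> (x $ i)) \<partial>(lborel :: (real ^ 'n) measure)) = 1"
    using isotropic_gaussian_nn_integral[OF z, of "\<lambda>_. 1"] prob_space.emeasure_space_1[OF M] by simp
  have "(\<integral>\<^sup>+\<omega>. ennreal (exp ((norm (orth_proj S (z \<omega>)))\<^sup>2 / (4 * \<sigma>\<^sup>2))) \<partial>M)
      = (\<integral>\<^sup>+x. ennreal (exp ((\<Sum>b\<in>B. (b \<bullet> x)\<^sup>2) / (4 * \<sigma>\<^sup>2))) * ennreal (\<Prod>i\<in>UNIV. normal_density 0 \<sigma> (x $ i)) \<partial>lborel)"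
    unfolding nrm by (rule isotropic_gaussian_nn_integral[OF z]) measurable
  also have "\<dots> = ennreal (sqrt 2 ^ dim S)"
    using gaussian_mgf_orthonormal[OF \<sigma> B(1,2,3)] by (simp add: one B(4))
  finally show ?thesis .
qed

text \<open>Chernoff's bound with the fixed exponent \<open>1 / (4 * \<sigma>\<^sup>2)\<close>; the
  scaling of the threshold makes the decay exactly \<open>exp (- t)\<close>.\<close>

lemma isotropic_gaussian_orth_proj_tail:
  assumes S: "subspace S"
  shows "measure M {\<omega> \<in> space M. 4 * \<sigma>\<^sup>2 * t < (norm (orth_proj S (z \<omega>)))\<^sup>2} \<le> sqrt 2 ^ dim S * exp (- t)"
proof -
  interpret prob_space M by (rule M)
  have [measurable]: "(\<lambda>\<omega>. orth_proj S (z \<omega>)) \<in> borel_measurable M"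
    using S by (rule borel_measurable_orth_proj) simp
  let ?A = "{\<omega> \<in> space M. 4 * \<sigma>\<^sup>2 * t < (norm (orth_proj S (z \<omega>)))\<^sup>2}"
  have "emeasure M ?A = (\<integral>\<^sup>+\<omega>. indicator ?A \<omega> \<partial>M)" by simp
  also have "\<dots> \<le> (\<integral>\<^sup>+\<omega>. ennreal (exp (- t)) * ennreal (exp ((norm (orth_proj S (z \<omega>)))\<^sup>2 / (4 * \<sigma>\<^sup>2))) \<partial>M)"
  proof (rule nn_integral_mono)
    fix \<omega> assume "\<omega> \<in> space M"
    have "1 \<le> exp (- t) * exp ((norm (orth_proj S (z \<omega>)))\<^sup>2 / (4 * \<sigma>\<^sup>2))" if "\<omega> \<in> ?A"
      unfolding exp_add[symmetric] using that \<sigma> by (simp add: field_simps)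
    then show "indicator ?A \<omega> \<le> ennreal (exp (- t)) * ennreal (exp ((norm (orth_proj S (z \<omega>)))\<^sup>2 / (4 * \<sigma>\<^sup>2)))"
      by (auto simp: indicator_def simp flip: ennreal_mult)
  qed
  also have "\<dots> = ennreal (exp (- t)) * ennreal (sqrt 2 ^ dim S)"
    by (subst nn_integral_cmult) (simp_all add: isotropic_gaussian_mgf_orth_proj[OF S])
  also have "\<dots> = ennreal (sqrt 2 ^ dim S * exp (- t))"
    by (simp add: ennreal_mult mult.commute)
  finally show ?thesis by (simp add: emeasure_eq_measure)
qed

text \<open>The bound must hold for all \<open>K\<close> at once, because it is later applied to a
  set that depends on the noise.\<close>

lemma prob_proj_cols_bound:
  fixes X :: "real ^ 'p ^ 'n"
  assumes c: "c \<ge> 0"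
  shows "measure M {\<omega> \<in> space M. \<forall>K. (norm (proj_cols X K (z \<omega>)))\<^sup>2
            \<le> 4 * \<sigma>\<^sup>2 * ((2 * real (card K) + c) * ln (real CARD('p)) + real (card K) / 2 * ln 2)}
          \<ge> 1 - 3 * real CARD('p) powr (- c)"
proof -
  interpret prob_space M by (rule M)
  define p where "p = real CARD('p)"
  have p: "p \<ge> 1" by (simp add: p_def Suc_le_eq)
  \<comment> \<open>The three terms have separate tasks: \<open>2 * card K * ln p\<close> gives
    summable weights \<open>(1 / p\<^sup>2) ^ card K\<close>, \<open>c * ln p\<close> gives the
    factor \<open>p powr (- c)\<close>, and the term with \<open>ln 2\<close> cancels
    \<open>sqrt 2 ^ card K\<close>.\<close>
  define t where "t K = (2 * real (card K) + c) * ln p + real (card K) / 2 * ln 2" for K :: "'p set"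
  define A where "A K = {\<omega> \<in> space M. 4 * \<sigma>\<^sup>2 * t K < (norm (proj_cols X K (z \<omega>)))\<^sup>2}" for K
  have [measurable]: "(\<lambda>\<omega>. proj_cols X K (z \<omega>)) \<in> borel_measurable M" for K
    unfolding proj_cols_def by (rule borel_measurable_orth_proj) simp_all
  have A: "A K \<in> events" for K unfolding A_def by measurable
  have bound: "prob (A K) \<le> p powr (- c) * (1 / p\<^sup>2) ^ card K" for K
  proof -
    have "prob (A K) \<le> sqrt 2 ^ dim (span ((\<lambda>j. column j X) ` K)) * exp (- t K)"
      unfolding A_def proj_cols_def by (rule isotropic_gaussian_orth_proj_tail) simp
    also have "\<dots> \<le> sqrt 2 ^ card K * exp (- t K)"
      by (intro mult_right_mono power_increasing dim_span_columns_le) auto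
    also have "sqrt 2 ^ card K = exp (real (card K) / 2 * ln 2)"
      by (simp add: powr_half_sqrt[symmetric] powr_def exp_of_nat_mult[symmetric])
    also have "exp (real (card K) / 2 * ln 2) * exp (- t K) = exp (- c * ln p) * exp (- (2 * ln p)) ^ card K"
      unfolding exp_of_nat_mult[symmetric] exp_add[symmetric] by (simp add: t_def algebra_simps)
    also have "exp (- (2 * ln p)) = 1 / p\<^sup>2"
      using p by (simp add: exp_minus exp_double inverse_eq_divide)
    also have "exp (- c * ln p) = p powr (- c)"
      using p by (simp add: powr_def)
    finally show ?thesis .
  qed
  have "prob (\<Union>K. A K) \<le> (\<Sum>K\<in>UNIV. prob (A K))"
    using A by (intro finite_measure_subadditive_finite) auto
  also have "\<dots> \<le> (\<Sum>K\<in>(UNIV :: 'p set set). p powr (- c) * (1 / p\<^sup>2) ^ card K)"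
    by (intro sum_mono bound)
  also have "\<dots> = p powr (- c) * (1 + 1 / p\<^sup>2) ^ CARD('p)"
    using sum_power_card_subsets[of "UNIV :: 'p set" "1 / p\<^sup>2"] by (simp flip: sum_distrib_left)
  \<comment> \<open>Origin of the constant 3: the total weight is at most
    \<open>exp (1 / p)\<close>, hence at most \<open>exp 1\<close>, which is below 3.\<close>
  also have "\<dots> \<le> p powr (- c) * exp 1"
  proof (rule mult_left_mono)
    have "(1 + 1 / p\<^sup>2) ^ CARD('p) \<le> exp (1 / p\<^sup>2) ^ CARD('p)"
      by (intro power_mono exp_ge_add_one_self) simp
    also have "\<dots> = exp (1 / p)"
      using p by (simp add: p_def power2_eq_square flip: exp_of_nat_mult)
    also have "\<dots> \<le> exp 1" using p by simp
    finally show "(1 + 1 / p\<^sup>2) ^ CARD('p) \<le> exp 1" .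
  qed simp
  also have "\<dots> \<le> p powr (- c) * 3" by (intro mult_left_mono exp_le) simp
  finally have "1 - 3 * p powr (- c) \<le> 1 - prob (\<Union>K. A K)" by simp
  also have "\<dots> = prob (space M - (\<Union>K. A K))"
    using A by (intro prob_compl[symmetric]) auto
  also have "space M - (\<Union>K. A K) = {\<omega> \<in> space M. \<forall>K. (norm (proj_cols X K (z \<omega>)))\<^sup>2 \<le> 4 * \<sigma>\<^sup>2 * t K}"
    unfolding A_def by (auto simp flip: not_less)
  finally show ?thesis unfolding t_def p_def .
qed

end

subsection \<open>Maximisers of the posterior\<close>

lemma coef_support_axis: "coef_support (axis j 1) = {j}"
  by (auto simp: coef_support_def axis_def)

text \<open>The normalised vector \<open>w /\<^sub>R norm w\<close> competes in the inner infimum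
  and \<open>K\<close> in the outer one.\<close>

lemma nu_le_norm:
  fixes X :: "real ^ 'p ^ 'n"
  assumes w: "coef_support w \<subseteq> K" "w \<noteq> 0" and s: "real (card K) \<le> s"
  shows "nu X s * norm w \<le> norm (X *v w) / sqrt (real CARD('n))"
proof -
  let ?A = "\<lambda>J :: 'p set. {u :: real ^ 'p. coef_support u \<subseteq> J \<and> norm u = 1}"
  let ?f = "\<lambda>u. norm (X *v u) / sqrt (real CARD('n))"
  \<comment> \<open>A real infimum is meaningful only over a nonempty set bounded below;
    nonemptiness of every inner set lets 0 bound the outer family.\<close>
  have ne: "?A J \<noteq> {}" if J: "1 \<le> card J" for J
  proof -
    obtain j where "j \<in> J" using J by (metis card.empty ex_in_conv not_one_le_zero)
    then have "axis j 1 \<in> ?A J" by (simp add: coef_support_axis)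
    then show ?thesis by blast
  qed
  have bdd: "bdd_below (?f ` ?A J)" for J by (rule bdd_belowI[of _ 0]) auto
  have bdd': "bdd_below ((\<lambda>J. INF u\<in>?A J. ?f u) ` {J. 1 \<le> card J \<and> real (card J) \<le> s})"
    by (rule bdd_belowI2[of _ 0]) (auto intro!: cINF_greatest ne)
  have "coef_support w \<noteq> {}" using w(2) by (auto simp: coef_support_def vec_eq_iff)
  then have K: "1 \<le> card K" using w(1) by (metis One_nat_def Suc_leI card_gt_0_iff finite subset_empty)
  define u where "u = w /\<^sub>R norm w"
  have u: "u \<in> ?A K" using w by (auto simp: u_def coef_support_def)
  have "nu X s \<le> (INF u\<in>?A K. ?f u)"
    unfolding nu_def using K s by (intro cINF_lower bdd') auto
  also have "\<dots> \<le> ?f u" using u by (intro cINF_lower bdd)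
  also have "\<dots> = ?f w / norm w" by (simp add: u_def matrix_vector_mult_scaleR field_simps)
  finally show ?thesis using w(2) by (simp add: field_simps)
qed

text \<open>Lets a nonzero \<open>nu\<close> be treated as positive; \<open>1 \<le> s\<close> admits
  the singletons, so the outer infimum is over a nonempty family.\<close>

lemma nu_nonneg:
  fixes X :: "real ^ 'p ^ 'n"
  assumes s: "1 \<le> s"
  shows "0 \<le> nu X s"
  unfolding nu_def
proof (rule cINF_greatest)
  fix J :: "'p set" assume "J \<in> {J. 1 \<le> card J \<and> real (card J) \<le> s}"
  then obtain j where j: "j \<in> J" by (metis (no_types, lifting) card.empty ex_in_conv mem_Collect_eq not_one_le_zero)
  have "axis j 1 \<in> {u :: real ^ 'p. coef_support u \<subseteq> J \<and> norm u = 1}"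
    using j by (simp add: coef_support_axis)
  then show "0 \<le> (INF u\<in>{u :: real ^ 'p. coef_support u \<subseteq> J \<and> norm u = 1}. norm (X *v u) / sqrt (real CARD('n)))"
    by (intro cINF_greatest) auto
next
  have "{undefined} \<in> {J :: 'p set. 1 \<le> card J \<and> real (card J) \<le> s}" using s by simp
  then show "{J :: 'p set. 1 \<le> card J \<and> real (card J) \<le> s} \<noteq> {}" by blast
qed

text \<open>Negative logarithms of the posterior weights, whose normalising constants cancel. The
  binomial coefficient of \<open>K\<close> is at most \<open>CARD('p) ^ card K\<close>, which costs
  the \<open>ln\<close> term, and that of \<open>J\<close> is at least 1.\<close>

lemma map_model_objective_le:
  fixes X :: "real ^ 'p ^ 'n"
  assumes J: "is_map_model sbar lam \<sigma> X y J" and K: "card K \<le> sbar"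
  shows "lam * real (card J) + (norm (y - proj_cols X J y))\<^sup>2 / (2 * \<sigma>\<^sup>2)
    \<le> (lam + ln (real CARD('p))) * real (card K) + (norm (y - proj_cols X K y))\<^sup>2 / (2 * \<sigma>\<^sup>2)"
proof -
  define w :: "'p set \<Rightarrow> real" where "w = prior_weight sbar lam"
  define R where "R I = (norm (y - proj_cols X I y))\<^sup>2 / (2 * \<sigma>\<^sup>2)" for I
  define Z where "Z = (\<Sum>I\<in>UNIV. w I)"
  define D where "D = (\<Sum>I\<in>UNIV. posterior_weight sbar lam \<sigma> X y I)"
  have choose_pos: "0 < real (CARD('p) choose card I)" for I :: "'p set"
    by (simp add: card_mono)
  have w0: "w I \<ge> 0" for I by (simp add: w_def prior_weight_def)
  have wK: "w K > 0" using K choose_pos by (simp add: w_def prior_weight_def)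
  have Z: "Z > 0" unfolding Z_def using w0 wK by (intro sum_pos2[of _ K]) auto
  have pw: "posterior_weight sbar lam \<sigma> X y I = w I * exp (- R I) / Z" for I
    by (simp add: posterior_weight_def prior_def w_def Z_def R_def)
  have D: "D > 0" unfolding D_def pw using w0 wK Z by (intro sum_pos2[of _ K]) auto
  have "posterior sbar lam \<sigma> X y K \<le> posterior sbar lam \<sigma> X y J"
    using J by (auto simp: is_map_model_def is_arg_max_linorder)
  then have le: "w K * exp (- R K) \<le> w J * exp (- R J)"
    unfolding posterior_def D_def[symmetric] pw using D Z by (simp add: divide_le_cancel)
  \<comment> \<open>The positive weight of \<open>K\<close> forces the maximiser to have positive
    weight, hence to respect the size bound \<open>sbar\<close>.\<close>
  moreover have "0 < w K * exp (- R K)" using wK by simp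
  ultimately have "w J \<noteq> 0" by auto
  then have Js: "card J \<le> sbar" by (auto simp: w_def prior_weight_def split: if_splits)
  have p: "real CARD('p) > 0" by simp
  have "exp (- ((lam + ln (real CARD('p))) * real (card K) + R K))
      = exp (- lam * real (card K)) / real CARD('p) ^ card K * exp (- R K)"
    using p by (simp add: exp_diff exp_minus exp_add distrib_right exp_of_nat_mult field_simps)
  also have "\<dots> \<le> w K * exp (- R K)"
    using K choose_pos[of K] binomial_le_pow[of "card K" "CARD('p)"]
    by (auto simp: w_def prior_weight_def card_mono simp flip: of_nat_power intro!: mult_right_mono divide_left_mono)
  also have "\<dots> \<le> w J * exp (- R J)" by (rule le)
  also have "\<dots> \<le> exp (- lam * real (card J)) * exp (- R J)"
  proof (rule mult_right_mono)
    have "1 \<le> real (CARD('p) choose card J)" using choose_pos[of J] by (simp add: Suc_le_eq)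
    then show "w J \<le> exp (- lam * real (card J))"
      using Js by (simp add: w_def prior_weight_def divide_le_eq)
  qed simp
  also have "\<dots> = exp (- (lam * real (card J) + R J))" by (simp flip: exp_add)
  finally show ?thesis by (simp add: R_def)
qed

text \<open>The deterministic part, on the event described by \<open>noise\<close>. With at least
  two columns, \<open>ln 2\<close> is at most \<open>ln (real CARD('p))\<close>, so all noise terms
  are measured in one logarithm.\<close>

lemma map_model_prediction_bound:
  fixes X :: "real ^ 'p ^ 'n" and \<beta> b :: "real ^ 'p" and y z :: "real ^ 'n"
  assumes \<sigma>: "\<sigma> > 0" and y: "y = X *v \<beta> + z"
    and s: "s = card (coef_support \<beta>)" "1 \<le> s" "s \<le> sbar"
    and \<epsilon>: "0 < \<epsilon>" "\<epsilon> \<le> 1 / 2" and c: "1 \<le> c" and p: "2 \<le> CARD('p)"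
    and lam: "lam = (1 + \<epsilon>) / \<epsilon> * (23 + 5 * c) * ln (real CARD('p))"
    and J: "is_map_model sbar lam \<sigma> X y J"
    and noise: "\<And>K. (norm (proj_cols X K z))\<^sup>2
      \<le> 4 * \<sigma>\<^sup>2 * ((2 * real (card K) + c) * ln (real CARD('p)) + real (card K) / 2 * ln 2)"
    and b: "coef_support b \<subseteq> J" "X *v b = proj_cols X J y"
  shows "real (card (J \<union> coef_support \<beta>)) \<le> (2 + \<epsilon>) * real s"
    and "(norm (X *v (b - \<beta>)))\<^sup>2 \<le> 8 * \<sigma>\<^sup>2 * real s * lam"
proof -
  define K where "K = J \<union> coef_support \<beta>"
  define L where "L = ln (real CARD('p))"
  define k where "k = real (card J)"
  define r where "r = real s"
  define l where "l = real (card K)"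
  define D where "D = X *v (b - \<beta>)"
  define Q where "Q = proj_cols X K z"
  have L2: "ln 2 \<le> L" using p by (simp add: L_def)
  have L0: "L > 0" using L2 by (rule less_le_trans[rotated]) simp
  have r1: "1 \<le> r" using s by (simp add: r_def)
  have k0: "0 \<le> k" and l0: "0 \<le> l" by (auto simp: k_def l_def)
  have l: "l \<le> k + r"
    unfolding l_def k_def r_def K_def s(1) using card_Un_le[of J "coef_support \<beta>"] by linarith
  have lamL: "lam = (1 + \<epsilon>) / \<epsilon> * ((23 + 5 * c) * L)" unfolding lam L_def by simp
  have lam0: "lam > 0" unfolding lamL using \<epsilon> c L0 by simp
  have supp: "coef_support (b - \<beta>) \<subseteq> K" using b(1) by (auto simp: K_def coef_support_def)
  have Xb: "y - X *v b = z - D"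
    by (simp add: y D_def matrix_vector_mult_diff_distrib)
  \<comment> \<open>The vector \<open>X *v \<beta>\<close> lies in the span for the true support and
    leaves residual \<open>z\<close>.\<close>
  have "norm (y - proj_cols X (coef_support \<beta>) y) \<le> norm (y - X *v \<beta>)"
    unfolding proj_cols_def by (intro norm_diff_orth_proj_le mult_in_span_columns) auto
  then have Rs: "(norm (y - proj_cols X (coef_support \<beta>) y))\<^sup>2 \<le> (norm z)\<^sup>2"
    by (intro power_mono) (simp_all add: y)
  have "lam * k + (norm (z - D))\<^sup>2 / (2 * \<sigma>\<^sup>2)
      \<le> (lam + L) * r + (norm (y - proj_cols X (coef_support \<beta>) y))\<^sup>2 / (2 * \<sigma>\<^sup>2)"
    using map_model_objective_le[OF J, of "coef_support \<beta>"] s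
    by (simp add: k_def r_def L_def Xb b(2)[symmetric])
  also have "\<dots> \<le> (lam + L) * r + (norm z)\<^sup>2 / (2 * \<sigma>\<^sup>2)"
    using Rs by (intro add_left_mono divide_right_mono) auto
  finally have "((norm (z - D))\<^sup>2 - (norm z)\<^sup>2) / (2 * \<sigma>\<^sup>2) \<le> (lam + L) * r - lam * k"
    by (simp add: diff_divide_distrib)
  then have "(norm (z - D))\<^sup>2 - (norm z)\<^sup>2 \<le> 2 * \<sigma>\<^sup>2 * ((lam + L) * r - lam * k)"
    using \<sigma> by (simp add: pos_divide_le_eq mult.commute)
  moreover have "(norm (z - D))\<^sup>2 - (norm z)\<^sup>2 = (norm D)\<^sup>2 - 2 * (z \<bullet> D)"
    by (simp add: power2_norm_eq_inner inner_diff_left inner_diff_right inner_commute[of D z])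
  \<comment> \<open>As \<open>D\<close> lies in the column span of \<open>K\<close>, only the
    projected noise \<open>Q\<close> meets it. The inequality \<open>2ab \<le> a^2/2 + 2b^2\<close>
    leaves half of the squared norm of \<open>D\<close> on the left.\<close>
  moreover have "2 * (z \<bullet> D) \<le> (norm D)\<^sup>2 / 2 + 2 * (norm Q)\<^sup>2"
  proof -
    have "z \<bullet> D = Q \<bullet> D"
      unfolding Q_def proj_cols_def D_def
      by (rule inner_orth_proj[symmetric]) (rule subspace_span, rule mult_in_span_columns[OF supp])
    also have "\<dots> \<le> norm Q * norm D" by (rule norm_cauchy_schwarz)
    finally have "2 * (z \<bullet> D) \<le> 2 * (norm Q * norm D)" by simp
    also have "\<dots> \<le> (norm D)\<^sup>2 / 2 + 2 * (norm Q)\<^sup>2"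
      using zero_le_power2[of "norm D - 2 * norm Q"] by (simp add: power2_diff power_mult_distrib mult.commute[of "norm Q"])
    finally show ?thesis .
  qed
  \<comment> \<open>The coefficient 10 is 8 from the union bound plus 2 from replacing
    \<open>ln 2\<close> by \<open>L\<close>.\<close>
  moreover have "(norm Q)\<^sup>2 \<le> \<sigma>\<^sup>2 * ((10 * (k + r) + 4 * c) * L)"
  proof -
    have "(norm Q)\<^sup>2 \<le> 4 * \<sigma>\<^sup>2 * ((2 * l + c) * L + l / 2 * ln 2)"
      unfolding Q_def l_def L_def by (rule noise)
    also have "\<dots> \<le> 4 * \<sigma>\<^sup>2 * ((2 * l + c) * L + l / 2 * L)"
      using L2 l0 by (intro mult_left_mono add_left_mono) auto
    also have "\<dots> = \<sigma>\<^sup>2 * ((10 * l + 4 * c) * L)" by (simp add: algebra_simps)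
    also have "\<dots> \<le> \<sigma>\<^sup>2 * ((10 * (k + r) + 4 * c) * L)"
      using l L0 by (intro mult_left_mono mult_right_mono) auto
    finally show ?thesis .
  qed
  ultimately have "(norm D)\<^sup>2 / 2 \<le> 2 * (\<sigma>\<^sup>2 * ((10 * (k + r) + 4 * c) * L)) + 2 * \<sigma>\<^sup>2 * ((lam + L) * r - lam * k)"
    by linarith
  then have D: "(norm D)\<^sup>2 \<le> 4 * \<sigma>\<^sup>2 * ((10 * (k + r) + 4 * c + r) * L + lam * (r - k))"
    by (simp add: algebra_simps)
  have k: "k \<le> (1 + \<epsilon>) * r"
  proof (rule ccontr)
    assume "\<not> k \<le> (1 + \<epsilon>) * r"
    then have *: "(1 + \<epsilon>) * r < k" by simp
    moreover have "r \<le> (1 + \<epsilon>) * r" using \<epsilon> r1 by (simp add: algebra_simps)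
    ultimately have rk: "r < k" by simp
    \<comment> \<open>This is why \<open>lam\<close> carries the factor
      \<open>(1 + \<epsilon>) / \<epsilon>\<close>: for an oversized model, the penalty on the
      excess \<open>k - r\<close> dominates \<open>(23 + 5 * c) * L\<close> times the full size
      \<open>k\<close>.\<close>
    have "k \<le> (1 + \<epsilon>) / \<epsilon> * (k - r)" using * \<epsilon> by (simp add: field_simps)
    then have "k * ((23 + 5 * c) * L) \<le> (1 + \<epsilon>) / \<epsilon> * (k - r) * ((23 + 5 * c) * L)"
      using c L0 by (intro mult_right_mono) auto
    also have "\<dots> = lam * (k - r)" by (simp add: lamL)
    finally have "(10 * (k + r) + 4 * c + r) * L + lam * (r - k)
        \<le> (10 * (k + r) + 4 * c + r - k * (23 + 5 * c)) * L"
      by (simp add: algebra_simps)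
    moreover have "10 * (k + r) + 4 * c + r - k * (23 + 5 * c) < 0"
    proof -
      have "c \<le> k * c" using mult_right_mono[of 1 k c] rk r1 c by simp
      then have "10 * k + 11 * r + 4 * c < 23 * k + 5 * (k * c)" using rk r1 c by linarith
      then show ?thesis by (simp add: algebra_simps)
    qed
    then have "(10 * (k + r) + 4 * c + r - k * (23 + 5 * c)) * L < 0"
      using L0 by (simp add: mult_less_0_iff)
    ultimately have "(10 * (k + r) + 4 * c + r) * L + lam * (r - k) < 0" by simp
    then have "4 * \<sigma>\<^sup>2 * ((10 * (k + r) + 4 * c + r) * L + lam * (r - k)) < 0"
      using \<sigma> by (intro mult_pos_neg) auto
    with D show False using zero_le_power2[of "norm D"] by linarith
  qed
  show "real (card (J \<union> coef_support \<beta>)) \<le> (2 + \<epsilon>) * real s"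
    using l k unfolding l_def K_def r_def by (simp add: algebra_simps)
  \<comment> \<open>Since \<open>k \<le> 3 / 2 * r\<close> and \<open>1 \<le> r\<close>, the bracket
    is at most \<open>26 * r + 4 * (r * c)\<close>, well below \<open>3 * (23 + 5 * c) * r\<close>;
    and \<open>(1 + \<epsilon>) / \<epsilon>\<close> is at least 3 for
    \<open>\<epsilon> \<le> 1 / 2\<close>.\<close>
  have "(10 * (k + r) + 4 * c + r) * L \<le> lam * r"
  proof -
    have "\<epsilon> * r \<le> 1 / 2 * r" using \<epsilon> r1 by (intro mult_right_mono) auto
    then have "k \<le> 3 / 2 * r" using k by (simp add: algebra_simps)
    moreover have "c \<le> r * c" using mult_right_mono[of 1 r c] r1 c by simp
    ultimately have "10 * k + 11 * r + 4 * c \<le> 69 * r + 15 * (r * c)"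
      using r1 c by linarith
    then have "10 * (k + r) + 4 * c + r \<le> 3 * (23 + 5 * c) * r" by (simp add: algebra_simps)
    then have "(10 * (k + r) + 4 * c + r) * L \<le> 3 * (23 + 5 * c) * r * L"
      using L0 by (intro mult_right_mono) auto
    also have "\<dots> = 3 * ((23 + 5 * c) * L) * r" by simp
    finally have "(10 * (k + r) + 4 * c + r) * L \<le> 3 * ((23 + 5 * c) * L) * r" .
    also have "\<dots> \<le> lam * r"
      unfolding lamL
    proof (intro mult_right_mono)
      show "3 \<le> (1 + \<epsilon>) / \<epsilon>" using \<epsilon> by (simp add: field_simps)
    qed (use c L0 r1 in auto)
    finally show ?thesis .
  qed
  moreover have "lam * (r - k) \<le> lam * r" using lam0 k0 by simp
  ultimately have "(10 * (k + r) + 4 * c + r) * L + lam * (r - k) \<le> 2 * (lam * r)" by simp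
  then have "4 * \<sigma>\<^sup>2 * ((10 * (k + r) + 4 * c + r) * L + lam * (r - k)) \<le> 4 * \<sigma>\<^sup>2 * (2 * (lam * r))"
    by (intro mult_left_mono) auto
  with D show "(norm (X *v (b - \<beta>)))\<^sup>2 \<le> 8 * \<sigma>\<^sup>2 * real s * lam"
    by (simp add: D_def r_def mult_ac)
qed

lemma map_model_estimation_bound:
  fixes X :: "real ^ 'p ^ 'n" and \<beta> b :: "real ^ 'p"
  assumes \<sigma>: "\<sigma> > 0" and supp: "coef_support (b - \<beta>) \<subseteq> K" and K: "real (card K) \<le> t"
    and t: "1 \<le> t" "nu X t \<noteq> 0" and C: "C \<ge> 0" "(norm (X *v (b - \<beta>)))\<^sup>2 \<le> \<sigma>\<^sup>2 * C"
  shows "norm (b - \<beta>) \<le> \<sigma> * sqrt (C / (real CARD('n) * (nu X t)\<^sup>2))"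
proof (cases "b - \<beta> = 0")
  case True
  then show ?thesis using \<sigma> C by simp
next
  case False
  have nu: "nu X t > 0" using nu_nonneg[OF t(1), of X] t(2) by simp
  have "nu X t * norm (b - \<beta>) \<le> norm (X *v (b - \<beta>)) / sqrt (real CARD('n))"
    by (rule nu_le_norm[OF supp False K])
  also have "norm (X *v (b - \<beta>)) \<le> \<sigma> * sqrt C"
    using C(2) \<sigma> real_le_rsqrt[OF C(2)] by (simp add: real_sqrt_mult)
  finally have "nu X t * norm (b - \<beta>) \<le> \<sigma> * sqrt C / sqrt (real CARD('n))"
    by (simp add: divide_right_mono)
  then show ?thesis
    using nu by (simp add: real_sqrt_divide real_sqrt_mult field_simps)
qed

section \<open>Measurability of the estimator and of the event of being a maximiser\<close>

lemma borel_measurable_beta_hat: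
  assumes [measurable]: "f \<in> borel_measurable N"
  shows "(\<lambda>x. beta_hat X (f x) J) \<in> borel_measurable N"
proof -
  have "(\<lambda>y. beta_hat X y J) \<in> borel_measurable borel"
    by (rule borel_measurable_linear) (rule linear_beta_hat)
  from measurable_compose[OF assms this] show ?thesis .
qed

text \<open>Being a maximiser is a conjunction of finitely many inequalities between posterior
  values, each measurable because projections are linear.\<close>

lemma measurable_is_map_model:
  fixes X :: "real ^ 'p ^ 'n"
  assumes [measurable]: "f \<in> borel_measurable N"
  shows "Measurable.pred N (\<lambda>x. is_map_model sbar lam \<sigma> X (f x) J)"
proof -
  have [measurable]: "(\<lambda>x. proj_cols X K (f x)) \<in> borel_measurable N" for K
    unfolding proj_cols_def by (rule borel_measurable_orth_proj) simp_all
  have [measurable]: "(\<lambda>x. posterior_weight sbar lam \<sigma> X (f x) K) \<in> borel_measurable N" for K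
    unfolding posterior_weight_def by measurable
  have [measurable]: "(\<lambda>x. posterior sbar lam \<sigma> X (f x) K) \<in> borel_measurable N" for K
    unfolding posterior_def by measurable
  show ?thesis
    unfolding is_map_model_def is_arg_max_linorder by measurable
qed

text \<open>Quantifying over every maximiser inside the event makes the bound independent of how
  ties are broken.\<close>

theorem theorem3:
  fixes M :: "'a measure"
    and X :: "real ^ 'p ^ 'n"
    and \<beta>star :: "real ^ 'p"
    and y z :: "'a \<Rightarrow> real ^ 'n"
    and \<sigma> \<epsilon> c lam :: real
    and sbar sstar :: nat
  assumes "prob_space M"
    and "CARD('n) \<le> CARD('p)"
    and "\<And>j. norm (column j X) = sqrt (real CARD('n))"
    and "\<sigma> > 0"
    and "isotropic_gaussian M \<sigma> z"
    and "y = (\<lambda>\<omega>. X *v \<beta>star + z \<omega>)"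
    and "sparsest_solution X (integral\<^sup>L M y) \<beta>star"
    and "sstar = card (coef_support \<beta>star)"
    and "1 \<le> sstar"
    and "sstar \<le> sbar"
    and "sbar \<le> CARD('p)"
    and "0 < \<epsilon>" and "\<epsilon> \<le> 1 / 2"
    and "1 \<le> c"
    and "lam = (1 + \<epsilon>) / \<epsilon> * (23 + 5 * c) * ln (real CARD('p))"
  shows "measure M {\<omega> \<in> space M. \<forall>J. is_map_model sbar lam \<sigma> X (y \<omega>) J \<longrightarrow>
            ereal (norm (beta_hat X (y \<omega>) J - \<beta>star))
              \<le> (if nu X ((2 + \<epsilon>) * real sstar) = 0 then \<infinity>
                 else ereal (\<sigma> * sqrt (8 * real sstar * lam /
                        (real CARD('n) * (nu X ((2 + \<epsilon>) * real sstar))\<^sup>2))))}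
          \<ge> 1 - 3 * real CARD('p) powr (- c)"
proof -
  interpret prob_space M by (rule assms(1))
  define r where "r = real sstar"
  define C where "C = 8 * r * lam"
  define nut where "nut = nu X ((2 + \<epsilon>) * r)"
  define B where "B = (if nut = 0 then \<infinity> else ereal (\<sigma> * sqrt (C / (real CARD('n) * nut\<^sup>2))))"
  define E where "E = {\<omega> \<in> space M. \<forall>J. is_map_model sbar lam \<sigma> X (y \<omega>) J \<longrightarrow>
    ereal (norm (beta_hat X (y \<omega>) J - \<beta>star)) \<le> B}"
  define G where "G = {\<omega> \<in> space M. \<forall>K. (norm (proj_cols X K (z \<omega>)))\<^sup>2
    \<le> 4 * \<sigma>\<^sup>2 * ((2 * real (card K) + c) * ln (real CARD('p)) + real (card K) / 2 * ln 2)}"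
  have "1 - 3 * real CARD('p) powr (- c) \<le> prob E"
  proof (cases "2 \<le> CARD('p)")
    \<comment> \<open>A single column gives \<open>ln 1 = 0\<close>, but then the claimed lower
      bound is \<open>1 - 3\<close>, which is negative.\<close>
    case False
    have "0 < CARD('p)" by simp
    with False have "CARD('p) = 1" by linarith
    then have "1 - 3 * real CARD('p) powr (- c) \<le> 0" by simp
    also have "0 \<le> prob E" by simp
    finally show ?thesis .
  next
    case True
    have zm [measurable]: "z \<in> borel_measurable M"
      by (rule isotropic_gaussian_measurable[OF assms(5)])
    have ym [measurable]: "y \<in> borel_measurable M" unfolding assms(6) by measurable
    have [measurable]: "(\<lambda>\<omega>. beta_hat X (y \<omega>) J) \<in> borel_measurable M" for J
      by (rule borel_measurable_beta_hat) (rule ym)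
    have [measurable]: "Measurable.pred M (\<lambda>\<omega>. is_map_model sbar lam \<sigma> X (y \<omega>) J)" for J
      by (rule measurable_is_map_model) (rule ym)
    \<comment> \<open>Monotonicity of the measure along \<open>G \<subseteq> E\<close> requires the
      larger set to be measurable.\<close>
    have E: "E \<in> events" unfolding E_def by measurable
    have "G \<subseteq> E"
    proof
      fix \<omega> assume \<omega>: "\<omega> \<in> G"
      have "ereal (norm (beta_hat X (y \<omega>) J - \<beta>star)) \<le> B"
        if J: "is_map_model sbar lam \<sigma> X (y \<omega>) J" for J
      proof (cases "nut = 0")
        case True
        then show ?thesis by (simp add: B_def)
      next
        case nz: False
        define b where "b = beta_hat X (y \<omega>) J"
        have b: "coef_support b \<subseteq> J" "X *v b = proj_cols X J (y \<omega>)"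
          unfolding b_def by (rule coef_support_beta_hat, rule mult_beta_hat)
        have y: "y \<omega> = X *v \<beta>star + z \<omega>" using assms(6) by simp
        have noise: "(norm (proj_cols X K (z \<omega>)))\<^sup>2
          \<le> 4 * \<sigma>\<^sup>2 * ((2 * real (card K) + c) * ln (real CARD('p)) + real (card K) / 2 * ln 2)" for K
          using \<omega> by (simp add: G_def)
        note bounds = map_model_prediction_bound[OF assms(4) y assms(8-10,12-14) True assms(15) J noise b]
        have supp: "coef_support (b - \<beta>star) \<subseteq> J \<union> coef_support \<beta>star"
          using b(1) by (auto simp: coef_support_def)
        have r1: "1 \<le> r" using assms(9) by (simp add: r_def)
        have "1 * 1 \<le> (2 + \<epsilon>) * r" using r1 assms(12) by (intro mult_mono) auto
        then have t1: "1 \<le> (2 + \<epsilon>) * r" by simp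
        have C0: "0 \<le> C"
          unfolding C_def assms(15) using r1 True assms(12,14) by simp
        have "norm (b - \<beta>star) \<le> \<sigma> * sqrt (C / (real CARD('n) * nut\<^sup>2))"
          unfolding nut_def
        proof (rule map_model_estimation_bound[OF assms(4) supp _ t1 _ C0])
          show "real (card (J \<union> coef_support \<beta>star)) \<le> (2 + \<epsilon>) * r"
            using bounds(1) by (simp add: r_def)
          show "nu X ((2 + \<epsilon>) * r) \<noteq> 0" using nz by (simp add: nut_def)
          show "(norm (X *v (b - \<beta>star)))\<^sup>2 \<le> \<sigma>\<^sup>2 * C"
            using bounds(2) by (simp add: C_def r_def mult.assoc mult.left_commute)
        qed
        then show ?thesis using nz by (simp add: B_def b_def)
      qed
      with \<omega> show "\<omega> \<in> E" by (simp add: E_def G_def)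
    qed
    then have "prob G \<le> prob E" using E by (intro finite_measure_mono)
    moreover have "1 - 3 * real CARD('p) powr (- c) \<le> prob G"
      unfolding G_def using assms(14) by (intro prob_proj_cols_bound[OF assms(1,4,5)]) simp
    ultimately show ?thesis by simp
  qed
  then show ?thesis
    unfolding E_def B_def C_def nut_def r_def by simp
qed

end
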